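(* Let $u, v\in[0,1]^d$ with $\lVert u\rVert_1\le1$ and $\lVert v\rVert_1\le 1$, and let $\alpha,\beta\in(0,1]$. Let $\tilde u$ be an $\alpha$-mass subvector sketch of $u$ and $\tilde v$ a $\beta$-mass subvector sketch of $v$. Let $\mathcal{I}=\{i : u_i\neq 0 \text{ and } v_i\neq 0\}$, and for a vector $x$ let $x_{\mathcal I}$ denote $x$ restricted to $\mathcal I$ (coordinates outside $\mathcal I$ set to $0$). Then $$\langle u,v\rangle-\langle\tilde u,\tilde v\rangle\le(1-\alpha)\lVert u\rVert_1\cdot(1-\beta)\lVert v\rVert_1+\lVert u_{\mathcal I}\rVert_1\cdot(1-\beta)\lVert v\rVert_1+\lVert v_{\mathcal I}\rVert_1\cdot(1-\alpha)\lVert u\rVert_1.$$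
   Context: $\alpha$-mass subvector sketch: for $u\in[0,1]^d$ with $\lVert u\rVert_1\le 1$ and $\alpha\in(0,1]$, take a permutation $\pi$ of $\{1,\ldots,d\}$ with $|u_{\pi_i}|\ge |u_{\pi_{i+1}}|$ for all $i$, and let $j$ be the smallest integer with $\sum_{i=1}^j |u_{\pi_i}|\ge\alpha\lVert u\rVert_1$. The sketch $\tilde u$ is the vector with $\tilde u_{\pi_i}=u_{\pi_i}$ for $i\le j$ and all other coordinates $0$. The inner product of sketches is the ordinary inner product $\langle\tilde u,\tilde v\rangle=\sum_i\tilde u_i\tilde v_i$. $\lVert\cdot\rVert_1$ is the $\ell_1$ norm. *)

theory Defs
  imports "HOL-Analysis.Analysis"
begin

definition l1_norm :: "real ^ 'n \<Rightarrow> real"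
  where "l1_norm x = (\<Sum>i\<in>UNIV. \<bar>x $ i\<bar>)"

definition restrict_coords :: "'n set \<Rightarrow> real ^ 'n \<Rightarrow> real ^ 'n"
  where "restrict_coords S x = (\<chi> i. if i \<in> S then x $ i else 0)"

text \<open>
  The sorting permutation is an enumeration of the index type by \<open>{1..CARD('n)}\<close>. As ties may be
  broken in several ways, being a sketch is a relation between \<open>u\<close> and \<open>s\<close>. For \<open>u = 0\<close> the least
  prefix length is \<open>0\<close> (empty sum); for \<open>\<alpha> \<le> 1\<close> it is at most \<open>CARD('n)\<close>.
\<close>

definition mass_subvector_sketch :: "real \<Rightarrow> real ^ 'n \<Rightarrow> real ^ 'n \<Rightarrow> bool"
  where "mass_subvector_sketch \<alpha> u s \<longleftrightarrow>
    (\<exists>\<pi>. bij_betw \<pi> {1..CARD('n)} (UNIV :: 'n set) \<and>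
         (\<forall>i\<in>{1..<CARD('n)}. \<bar>u $ \<pi> i\<bar> \<ge> \<bar>u $ \<pi> (i + 1)\<bar>) \<and>
         (let j = (LEAST j::nat. (\<Sum>i=1..j. \<bar>u $ \<pi> i\<bar>) \<ge> \<alpha> * l1_norm u)
          in \<forall>i\<in>{1..CARD('n)}. s $ \<pi> i = (if i \<le> j then u $ \<pi> i else 0)))"

end

theory Submission
  imports Defs
begin

text \<open>
  Write \<open>\<langle>u, v\<rangle> - \<langle>u', v'\<rangle> = \<langle>u, v - v'\<rangle> + \<langle>u - u', v'\<rangle>\<close>. The dropped part \<open>v - v'\<close> has mass at most
  \<open>(1 - \<beta>) \<parallel>v\<parallel>\<^sub>1\<close> and is supported where \<open>v\<close> is, so it meets \<open>u\<close> only on \<open>I\<close>, where each entry of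
  \<open>u\<close> is at most \<open>\<parallel>u\<^sub>I\<parallel>\<^sub>1\<close>; the second summand is symmetric because \<open>0 \<le> v' \<le> v\<close>. The product term
  of the bound is only needed to be nonnegative.
\<close>

lemma l1_norm_nonneg: "0 \<le> l1_norm x"
  by (simp add: l1_norm_def sum_nonneg)

lemma component_le_l1_norm: "\<bar>x $ i\<bar> \<le> l1_norm x"
  unfolding l1_norm_def by (rule member_le_sum) auto

text \<open>The enumeration is onto, so every coordinate is \<open>\<pi> k\<close> for some
  \<open>k\<close> and is either kept or zeroed. This form hides the enumeration from later
  pointwise arguments.\<close>

lemma mass_subvector_sketch_component:
  assumes "mass_subvector_sketch \<alpha> u s"
  shows "s $ i = u $ i \<or> s $ i = 0"
proof -
  obtain \<pi> j where "bij_betw \<pi> {1..CARD('a)} (UNIV :: 'a set)"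
    and s: "\<And>k. k \<in> {1..CARD('a)} \<Longrightarrow> s $ \<pi> k = (if k \<le> j then u $ \<pi> k else 0)"
    using assms unfolding mass_subvector_sketch_def Let_def by blast
  then obtain k where "k \<in> {1..CARD('a)}" "i = \<pi> k"
    unfolding bij_betw_def by blast
  with s show ?thesis by auto
qed

lemma mass_subvector_sketch_mass:
  assumes "mass_subvector_sketch \<alpha> u s" and "\<alpha> \<le> 1"
  shows "\<alpha> * l1_norm u \<le> l1_norm s"
proof -
  obtain \<pi> where bij: "bij_betw \<pi> {1..CARD('a)} (UNIV :: 'a set)"
    and s: "\<And>k. k \<in> {1..CARD('a)} \<Longrightarrow> s $ \<pi> k =
      (if k \<le> (LEAST j::nat. (\<Sum>i=1..j. \<bar>u $ \<pi> i\<bar>) \<ge> \<alpha> * l1_norm u) then u $ \<pi> k else 0)"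
    using assms(1) unfolding mass_subvector_sketch_def Let_def by blast
  define P where "P j \<longleftrightarrow> (\<Sum>i=1..j. \<bar>u $ \<pi> i\<bar>) \<ge> \<alpha> * l1_norm u" for j :: nat
  have reindex: "(\<Sum>i=1..CARD('a). \<bar>x $ \<pi> i\<bar>) = l1_norm x" for x
    unfolding l1_norm_def using sum.reindex_bij_betw[OF bij] .
  \<comment> \<open>The whole enumeration carries mass \<open>l1_norm u\<close>, which reaches the
    threshold as \<open>\<alpha> \<le> 1\<close>. Hence the \<open>LEAST\<close> is attained, and
    its value stays in the index range where \<open>s\<close> is described.\<close>
  have full: "P CARD('a)"
    unfolding P_def reindex using mult_right_mono[OF assms(2) l1_norm_nonneg[of u]] by simp
  define j where "j = (LEAST j. P j)"
  have "P j" and "j \<le> CARD('a)"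
    unfolding j_def using full by (auto intro: LeastI Least_le)
  have s': "s $ \<pi> k = (if k \<le> j then u $ \<pi> k else 0)" if "k \<in> {1..CARD('a)}" for k
    using s[OF that] unfolding j_def P_def .
  have "\<alpha> * l1_norm u \<le> (\<Sum>i=1..j. \<bar>u $ \<pi> i\<bar>)"
    using \<open>P j\<close> unfolding P_def .
  also have "\<dots> = (\<Sum>i=1..j. \<bar>s $ \<pi> i\<bar>)"
    using \<open>j \<le> CARD('a)\<close> by (intro sum.cong) (auto simp: s')
  also have "\<dots> \<le> (\<Sum>i=1..CARD('a). \<bar>s $ \<pi> i\<bar>)"
    using \<open>j \<le> CARD('a)\<close> by (intro sum_mono2) auto
  finally show ?thesis unfolding reindex .
qed

text \<open>Kept and dropped coordinates are disjoint, so the masses of \<open>s\<close> and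
  \<open>u - s\<close> add up to that of \<open>u\<close>.\<close>

lemma mass_subvector_sketch_residual:
  assumes "mass_subvector_sketch \<alpha> u s" and "\<alpha> \<le> 1"
  shows "l1_norm (u - s) \<le> (1 - \<alpha>) * l1_norm u"
proof -
  have "\<bar>u $ i - s $ i\<bar> = \<bar>u $ i\<bar> - \<bar>s $ i\<bar>" for i
    using mass_subvector_sketch_component[OF assms(1), of i] by auto
  then have "l1_norm (u - s) = l1_norm u - l1_norm s"
    by (simp add: l1_norm_def sum_subtractf)
  then show ?thesis
    using mass_subvector_sketch_mass[OF assms] by (simp add: algebra_simps)
qed

text \<open>Hoelder's inequality on \<open>S\<close>, with the maximum of \<open>x\<close> over
  \<open>S\<close> bounded by its sum there; terms off \<open>S\<close> vanish by
  hypothesis.\<close>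

lemma inner_le_l1_norm_restrict:
  assumes "\<And>i. i \<notin> S \<Longrightarrow> x $ i * y $ i = 0"
  shows "x \<bullet> y \<le> l1_norm (restrict_coords S x) * l1_norm y"
proof -
  have "x $ i * y $ i \<le> l1_norm (restrict_coords S x) * \<bar>y $ i\<bar>" for i
  proof (cases "i \<in> S")
    case True
    have "x $ i * y $ i \<le> \<bar>x $ i\<bar> * \<bar>y $ i\<bar>"
      by (metis abs_ge_self abs_mult)
    also have "\<dots> \<le> l1_norm (restrict_coords S x) * \<bar>y $ i\<bar>"
      using component_le_l1_norm[of "restrict_coords S x" i] True
      by (intro mult_right_mono) (auto simp: restrict_coords_def)
    finally show ?thesis .
  next
    case False
    then show ?thesis by (simp add: assms l1_norm_nonneg)
  qed
  then show ?thesis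
    unfolding inner_vec_def l1_norm_def[of y] sum_distrib_left
    by (intro sum_mono) simp
qed

theorem theorem3p4:
  fixes u v u' v' :: "real ^ 'n" and \<alpha> \<beta> :: real and I :: "'n set"
  assumes "\<forall>i. u $ i \<in> {0..1}" and "\<forall>i. v $ i \<in> {0..1}"
    and "l1_norm u \<le> 1" and "l1_norm v \<le> 1"
    and "\<alpha> \<in> {0<..1}" and "\<beta> \<in> {0<..1}"
    and "mass_subvector_sketch \<alpha> u u'" and "mass_subvector_sketch \<beta> v v'"
    and "I = {i. u $ i \<noteq> 0 \<and> v $ i \<noteq> 0}"
  shows "u \<bullet> v - u' \<bullet> v' \<le>
      ((1 - \<alpha>) * l1_norm u) * ((1 - \<beta>) * l1_norm v)
    + l1_norm (restrict_coords I u) * ((1 - \<beta>) * l1_norm v)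
    + l1_norm (restrict_coords I v) * ((1 - \<alpha>) * l1_norm u)"
proof -
  note comp_u = mass_subvector_sketch_component[OF assms(7)]
  note comp_v = mass_subvector_sketch_component[OF assms(8)]
  have \<alpha>: "\<alpha> \<le> 1" and \<beta>: "\<beta> \<le> 1"
    using assms(5,6) by auto
  have nonneg: "0 \<le> u $ i" "0 \<le> v $ i" for i
    using assms(1,2) by auto
  have zero: "u $ i = 0 \<Longrightarrow> u' $ i = 0" "v $ i = 0 \<Longrightarrow> v' $ i = 0" for i
    using comp_u[of i] comp_v[of i] by auto
  \<comment> \<open>Off \<open>I\<close>, either \<open>u $ i = 0\<close>, or
    \<open>v $ i = 0\<close> and then also \<open>v' $ i = 0\<close>.\<close>
  have "u \<bullet> (v - v') \<le> l1_norm (restrict_coords I u) * l1_norm (v - v')"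
    by (intro inner_le_l1_norm_restrict) (auto simp: assms(9) zero)
  also have "\<dots> \<le> l1_norm (restrict_coords I u) * ((1 - \<beta>) * l1_norm v)"
    by (intro mult_left_mono mass_subvector_sketch_residual assms(8) \<beta> l1_norm_nonneg)
  finally have dropped_v:
    "u \<bullet> (v - v') \<le> l1_norm (restrict_coords I u) * ((1 - \<beta>) * l1_norm v)" .
  \<comment> \<open>Here \<open>u - u'\<close> is nonnegative and \<open>v'\<close> is at most
    \<open>v\<close>. The factors are swapped so that \<open>v\<close> is the vector restricted to
    \<open>I\<close> in the next bound.\<close>
  have "(u - u') $ i * v' $ i \<le> v $ i * (u - u') $ i" for i
    using comp_u[of i] comp_v[of i] nonneg[of i] by auto
  then have "(u - u') \<bullet> v' \<le> v \<bullet> (u - u')"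
    unfolding inner_vec_def by (intro sum_mono) simp
  also have "\<dots> \<le> l1_norm (restrict_coords I v) * l1_norm (u - u')"
    by (intro inner_le_l1_norm_restrict) (auto simp: assms(9) zero)
  also have "\<dots> \<le> l1_norm (restrict_coords I v) * ((1 - \<alpha>) * l1_norm u)"
    by (intro mult_left_mono mass_subvector_sketch_residual assms(7) \<alpha> l1_norm_nonneg)
  finally have dropped_u:
    "(u - u') \<bullet> v' \<le> l1_norm (restrict_coords I v) * ((1 - \<alpha>) * l1_norm u)" .
  have "0 \<le> ((1 - \<alpha>) * l1_norm u) * ((1 - \<beta>) * l1_norm v)"
    using \<alpha> \<beta> by (simp add: l1_norm_nonneg)
  moreover have "u \<bullet> v - u' \<bullet> v' = u \<bullet> (v - v') + (u - u') \<bullet> v'"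
    by (simp add: inner_diff_left inner_diff_right)
  ultimately show ?thesis
    using dropped_u dropped_v by linarith
qed

end
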